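(* Let $\Omega_1,\mathcal C_1\subset\mathbb R^n$ and $\Omega_2,\mathcal C_2\subset\mathbb R^m$ be nonempty sets with $\mathcal C_1,\mathcal C_2$ closed and convex, and let $(\bar x_1,\bar x_2)\in(\Omega_1\cap\mathcal C_1)\times(\Omega_2\cap\mathcal C_2)$, where $\Omega_i$ is locally closed around $\bar x_i$ for $i=1,2$. Then: (i) $\hat N_{\mathcal C_1\times\mathcal C_2}((\bar x_1,\bar x_2),\Omega_1\times\Omega_2)=\hat N_{\mathcal C_1}(\bar x_1,\Omega_1)\times\hat N_{\mathcal C_2}(\bar x_2,\Omega_2)$; (ii) $N_{\mathcal C_1\times\mathcal C_2}((\bar x_1,\bar x_2),\Omega_1\times\Omega_2)=N_{\mathcal C_1}(\bar x_1,\Omega_1)\times N_{\mathcal C_2}(\bar x_2,\Omega_2)$.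
   Context: All spaces are finite-dimensional with scalar product $\langle\cdot,\cdot\rangle$ and a norm; on a product, $\|(x,y)\|:=\|x\|+\|y\|$. $x_k\xrightarrow{A}\bar x$ means $x_k\to\bar x$ with $x_k\in A$ for all $k$. A set is locally closed around a point if its intersection with every sufficiently small closed ball centered at the point is closed. For a closed convex set $\mathcal C\subset\mathbb R^s$, a set $\Omega\subset\mathbb R^s$ and $\bar x\in\Omega\cap\mathcal C$, the Fréchet normal cone to $\Omega$ at $\bar x$ with respect to $\mathcal C$ is $$\hat N_{\mathcal C}(\bar x,\Omega):=\Big\{x^*\in\mathbb R^s\mid\exists p>0:\ \bar x+px^*\in\mathcal C,\ \limsup_{x\xrightarrow{\Omega\cap\mathcal C}\bar x}\tfrac{\langle x^*,x-\bar x\rangle}{\|x-\bar x\|}\le0\Big\}$$ (limsup over $x\neq\bar x$; i.e. for every $\epsilon>0$ there is $\delta>0$ with $\langle x^*,x-\bar x\rangle\le\epsilon\|x-\bar x\|$ for all $x\in\Omega\cap\mathcal C$ with $\|x-\bar x\|\le\delta$), and the limiting normal cone with respect to $\mathcal C$, $N_{\mathcal C}(\bar x,\Omega)$, is the set of all $x^*$ for which there are $x_k\xrightarrow{\Omega\cap\mathcal C}\bar x$ and $x_k^*\in\hat N_{\mathcal C}(x_k,\Omega)$ with $x_k^*\to x^*$. *)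

theory Defs
  imports "HOL-Analysis.Analysis"
begin

definition is_norm :: "('a::real_vector \<Rightarrow> real) \<Rightarrow> bool" where
  "is_norm N \<longleftrightarrow>
     (\<forall>x. N x = 0 \<longleftrightarrow> x = 0) \<and>
     (\<forall>a x. N (a *\<^sub>R x) = \<bar>a\<bar> * N x) \<and>
     (\<forall>x y. N (x + y) \<le> N x + N y)"

text \<open>
  The norm is an explicit parameter: the library norm on a product type is the Euclidean
  combination of the component norms, whereas here products carry their sum.
  Limits and closedness are taken in the library topology, which on a
  finite-dimensional space is the topology of every norm.
\<close>

definition sum_norm :: "('a \<Rightarrow> real) \<Rightarrow> ('b \<Rightarrow> real) \<Rightarrow> 'a \<times> 'b \<Rightarrow> real" where
  "sum_norm N1 N2 = (\<lambda>(x, y). N1 x + N2 y)"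

definition locally_closed_around ::
    "('a::euclidean_space \<Rightarrow> real) \<Rightarrow> 'a set \<Rightarrow> 'a \<Rightarrow> bool" where
  "locally_closed_around N \<Omega> x \<longleftrightarrow>
     (\<exists>r>0. \<forall>s. 0 < s \<and> s \<le> r \<longrightarrow> closed (\<Omega> \<inter> {y. N (y - x) \<le> s}))"

text \<open>
  If \<open>x\<close> is isolated in \<open>\<Omega> \<inter> C\<close>, the upper limit is \<open>-\<infinity>\<close>, so the inequality holds vacuously.
\<close>

definition frechet_normal_cone ::
    "('a::euclidean_space \<Rightarrow> real) \<Rightarrow> 'a set \<Rightarrow> 'a \<Rightarrow> 'a set \<Rightarrow> 'a set" where
  "frechet_normal_cone N C x \<Omega> =
     {x'. (\<exists>p>0. x + p *\<^sub>R x' \<in> C) \<and>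
          Limsup (at x within \<Omega> \<inter> C) (\<lambda>y. ereal ((x' \<bullet> (y - x)) / N (y - x))) \<le> 0}"

definition limiting_normal_cone ::
    "('a::euclidean_space \<Rightarrow> real) \<Rightarrow> 'a set \<Rightarrow> 'a \<Rightarrow> 'a set \<Rightarrow> 'a set" where
  "limiting_normal_cone N C x \<Omega> =
     {x'. \<exists>u v. (\<forall>k::nat. u k \<in> \<Omega> \<inter> C) \<and> u \<longlonglongrightarrow> x \<and>
            (\<forall>k. v k \<in> frechet_normal_cone N C (u k) \<Omega>) \<and> v \<longlonglongrightarrow> x'}"

end

theory Submission
  imports Defs
begin

text \<open>
  A normal to the product tested only at points \<open>(y, x2)\<close> or \<open>(x1, z)\<close> is a normal in each
  factor; conversely the two inequalities add up because the norm on the product is the sum.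
  Only the condition on \<open>p\<close> couples the factors in the converse direction, and by convexity
  each \<open>p\<close> may be decreased to a common value. The limiting cones inherit the equality
  term by term along the approximating sequences.
\<close>

lemma is_norm_0: "is_norm N \<Longrightarrow> N 0 = 0"
  by (simp add: is_norm_def)

text \<open>Nonnegativity is not among the axioms of \<open>is_norm\<close>; it comes from the
  triangle inequality for \<open>x\<close> and its negative, which gives 0 \<le> 2 *
  \<open>N x\<close>.\<close>

lemma is_norm_nonneg:
  assumes "is_norm N"
  shows "0 \<le> N x"
proof -
  have "N (x + (-1) *\<^sub>R x) \<le> N x + N ((-1) *\<^sub>R x)" and "N ((-1) *\<^sub>R x) = \<bar>-1\<bar> * N x"
    using assms unfolding is_norm_def by blast+
  with is_norm_0[OF assms] show ?thesis
    by simp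
qed

lemma is_norm_pos: "is_norm N \<Longrightarrow> x \<noteq> 0 \<Longrightarrow> 0 < N x"
  using is_norm_nonneg[of N x] by (metis is_norm_def order_le_less)

text \<open>This lets every fact about an abstract norm be applied on the product as well.
  Definiteness rests on nonnegativity: a vanishing sum forces both summands to vanish.\<close>

lemma is_norm_sum_norm:
  assumes "is_norm N1" and "is_norm N2"
  shows "is_norm (sum_norm N1 N2)"
  unfolding is_norm_def
proof (intro conjI allI)
  fix x y :: "'a \<times> 'b" and a :: real
  show "sum_norm N1 N2 x = 0 \<longleftrightarrow> x = 0"
  proof (cases x)
    case (Pair b c)
    then show ?thesis
      using assms is_norm_nonneg[OF assms(1), of b] is_norm_nonneg[OF assms(2), of c]
      by (auto simp: sum_norm_def is_norm_def zero_prod_def add_nonneg_eq_0_iff)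
  qed
  show "sum_norm N1 N2 (a *\<^sub>R x) = \<bar>a\<bar> * sum_norm N1 N2 x"
    using assms by (cases x) (simp add: sum_norm_def is_norm_def algebra_simps)
  show "sum_norm N1 N2 (x + y) \<le> sum_norm N1 N2 x + sum_norm N1 N2 y"
  proof (cases x, cases y)
    fix b c b' c'
    assume "x = (b, c)" and "y = (b', c')"
    moreover have "N1 (b + b') \<le> N1 b + N1 b'" and "N2 (c + c') \<le> N2 c + N2 c'"
      using assms by (auto simp: is_norm_def)
    ultimately show ?thesis
      by (simp add: sum_norm_def)
  qed
qed

text \<open>Clearing the denominator turns the upper limit into linear inequalities that can be
  added. They hold trivially at \<open>y = x\<close>, so the neighbourhood need not be punctured;
  this matters on products, where one component may sit at its base point while the other
  moves.\<close>

lemma Limsup_quotient_le_0_iff: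
  fixes x x' :: "'a::euclidean_space"
  assumes N: "is_norm N"
  shows "Limsup (at x within A) (\<lambda>y. ereal ((x' \<bullet> (y - x)) / N (y - x))) \<le> 0 \<longleftrightarrow>
    (\<forall>e>0. \<exists>d>0. \<forall>y\<in>A. dist y x < d \<longrightarrow> x' \<bullet> (y - x) \<le> e * N (y - x))"
    (is "?L \<longleftrightarrow> ?R")
proof
  assume L: ?L
  show ?R
  proof (intro allI impI)
    fix e :: real
    assume "0 < e"
    with L have "\<forall>\<^sub>F y in at x within A. ereal ((x' \<bullet> (y - x)) / N (y - x)) < ereal e"
      unfolding Limsup_le_iff by (metis ereal_less(2))
    then obtain d where "d > 0"
      and d: "\<And>y. y \<in> A \<Longrightarrow> y \<noteq> x \<Longrightarrow> dist y x < d \<Longrightarrow> (x' \<bullet> (y - x)) / N (y - x) < e"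
      unfolding eventually_at by auto
    have "x' \<bullet> (y - x) \<le> e * N (y - x)" if "y \<in> A" "dist y x < d" for y
    proof (cases "y = x")
      case True
      then show ?thesis by (simp add: is_norm_0[OF N])
    next
      case False
      then show ?thesis
        using d[OF that(1) False that(2)] is_norm_pos[OF N, of "y - x"]
        by (simp add: pos_divide_less_eq)
    qed
    with \<open>d > 0\<close> show "\<exists>d>0. \<forall>y\<in>A. dist y x < d \<longrightarrow> x' \<bullet> (y - x) \<le> e * N (y - x)"
      by blast
  qed
next
  assume R: ?R
  show ?L
    unfolding Limsup_le_iff
  proof (intro allI impI)
    fix c :: ereal
    assume "0 < c"
    \<comment> \<open>A real number strictly between 0 and the possibly infinite \<open>c\<close>:
      the hypothesis yields only a non-strict bound by \<open>e\<close>, whereas a strict bound by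
      \<open>c\<close> is required.\<close>
    then obtain e where "0 < e" and e: "ereal e < c"
      by (metis ereal_dense2 ereal_less(2))
    with R obtain d where "d > 0"
      and d: "\<And>y. y \<in> A \<Longrightarrow> dist y x < d \<Longrightarrow> x' \<bullet> (y - x) \<le> e * N (y - x)"
      by blast
    have "ereal ((x' \<bullet> (y - x)) / N (y - x)) < c" if "y \<in> A" "y \<noteq> x" "dist y x < d" for y
    proof -
      have "(x' \<bullet> (y - x)) / N (y - x) \<le> e"
        using d[OF that(1,3)] is_norm_pos[OF N, of "y - x"] that(2)
        by (simp add: pos_divide_le_eq)
      with e show ?thesis
        by (meson ereal_less_eq(3) order_le_less_trans)
    qed
    with \<open>d > 0\<close> show "\<forall>\<^sub>F y in at x within A. ereal ((x' \<bullet> (y - x)) / N (y - x)) < c"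
      unfolding eventually_at by blast
  qed
qed

lemma frechet_normal_cone_iff:
  assumes "is_norm N"
  shows "x' \<in> frechet_normal_cone N C x \<Omega> \<longleftrightarrow>
    (\<exists>p>0. x + p *\<^sub>R x' \<in> C) \<and>
    (\<forall>e>0. \<exists>d>0. \<forall>y\<in>\<Omega> \<inter> C. dist y x < d \<longrightarrow> x' \<bullet> (y - x) \<le> e * N (y - x))"
  unfolding frechet_normal_cone_def
  by (simp only: mem_Collect_eq Limsup_quotient_le_0_iff[OF assms])

text \<open>The new point is the convex combination of \<open>x\<close> and
  \<open>x + p *\<^sub>R v\<close> with weight \<open>q / p\<close> on the latter.\<close>

lemma convex_ray_shrink:
  assumes "convex C" and "x \<in> C" and "x + p *\<^sub>R v \<in> C" and "0 < p" and "0 \<le> q" and "q \<le> p"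
  shows "x + q *\<^sub>R v \<in> C"
proof -
  have "(1 - q / p) *\<^sub>R x + (q / p) *\<^sub>R (x + p *\<^sub>R v) \<in> C"
    using assms by (intro convexD) auto
  also have "(1 - q / p) *\<^sub>R x + (q / p) *\<^sub>R (x + p *\<^sub>R v) = x + q *\<^sub>R v"
    using \<open>0 < p\<close> by (simp add: algebra_simps)
  finally show ?thesis .
qed

lemma frechet_normal_cone_Times:
  fixes \<Omega>1 C1 :: "'a::euclidean_space set" and \<Omega>2 C2 :: "'b::euclidean_space set"
  assumes N: "is_norm N1" "is_norm N2"
    and C: "convex C1" "convex C2"
    and x1: "x1 \<in> \<Omega>1 \<inter> C1" and x2: "x2 \<in> \<Omega>2 \<inter> C2"
  shows "frechet_normal_cone (sum_norm N1 N2) (C1 \<times> C2) (x1, x2) (\<Omega>1 \<times> \<Omega>2)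
    = frechet_normal_cone N1 C1 x1 \<Omega>1 \<times> frechet_normal_cone N2 C2 x2 \<Omega>2"
    (is "?L = ?R1 \<times> ?R2")
proof (rule set_eqI)
  note iff = frechet_normal_cone_iff[OF N(1)] frechet_normal_cone_iff[OF N(2)]
    frechet_normal_cone_iff[OF is_norm_sum_norm[OF N]]
  fix x' :: "'a \<times> 'b"
  obtain a b where x': "x' = (a, b)"
    by fastforce
  have "a \<in> ?R1 \<and> b \<in> ?R2" if L: "(a, b) \<in> ?L"
  proof -
    \<comment> \<open>The step length for the pair serves both components at once.\<close>
    obtain p where p: "p > 0" "x1 + p *\<^sub>R a \<in> C1" "x2 + p *\<^sub>R b \<in> C2"
      using L unfolding iff by auto
    have "\<exists>d>0. (\<forall>y\<in>\<Omega>1 \<inter> C1. dist y x1 < d \<longrightarrow> a \<bullet> (y - x1) \<le> e * N1 (y - x1)) \<and>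
      (\<forall>z\<in>\<Omega>2 \<inter> C2. dist z x2 < d \<longrightarrow> b \<bullet> (z - x2) \<le> e * N2 (z - x2))" if "e > 0" for e
    proof -
      obtain d where "d > 0"
        and d: "\<And>w. w \<in> (\<Omega>1 \<times> \<Omega>2) \<inter> (C1 \<times> C2) \<Longrightarrow> dist w (x1, x2) < d \<Longrightarrow>
          (a, b) \<bullet> (w - (x1, x2)) \<le> e * sum_norm N1 N2 (w - (x1, x2))"
        using L \<open>e > 0\<close> unfolding iff by blast
      \<comment> \<open>With the second component frozen at \<open>x2\<close>, its contributions to
        the inner product, to the norm and to the distance are all zero.\<close>
      have "a \<bullet> (y - x1) \<le> e * N1 (y - x1)" if "y \<in> \<Omega>1 \<inter> C1" "dist y x1 < d" for y
        using d[of "(y, x2)"] that x2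
        by (simp add: dist_Pair_Pair sum_norm_def is_norm_0[OF N(2)])
      moreover have "b \<bullet> (z - x2) \<le> e * N2 (z - x2)" if "z \<in> \<Omega>2 \<inter> C2" "dist z x2 < d" for z
        using d[of "(x1, z)"] that x1
        by (simp add: dist_Pair_Pair sum_norm_def is_norm_0[OF N(1)])
      ultimately show ?thesis
        using \<open>d > 0\<close> by blast
    qed
    then have "\<forall>e>0. \<exists>d>0. \<forall>y\<in>\<Omega>1 \<inter> C1. dist y x1 < d \<longrightarrow> a \<bullet> (y - x1) \<le> e * N1 (y - x1)"
      and "\<forall>e>0. \<exists>d>0. \<forall>z\<in>\<Omega>2 \<inter> C2. dist z x2 < d \<longrightarrow> b \<bullet> (z - x2) \<le> e * N2 (z - x2)"
      by blast+
    with p show ?thesis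
      unfolding iff by blast
  qed
  moreover have "(a, b) \<in> ?L" if a: "a \<in> ?R1" and b: "b \<in> ?R2"
  proof -
    obtain p q where p: "p > 0" "x1 + p *\<^sub>R a \<in> C1" and q: "q > 0" "x2 + q *\<^sub>R b \<in> C2"
      using a b unfolding iff by blast
    \<comment> \<open>Membership in the cone of the product asks for a single step length; the
      smaller of the two is admissible in both factors.\<close>
    have "x1 + min p q *\<^sub>R a \<in> C1"
      using x1 p q by (intro convex_ray_shrink[OF C(1) _ p(2)]) auto
    moreover have "x2 + min p q *\<^sub>R b \<in> C2"
      using x2 p q by (intro convex_ray_shrink[OF C(2) _ q(2)]) auto
    ultimately have "(x1, x2) + min p q *\<^sub>R (a, b) \<in> C1 \<times> C2"
      by simp
    moreover have "min p q > 0"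
      using p q by simp
    moreover have "\<exists>d>0. \<forall>w\<in>(\<Omega>1 \<times> \<Omega>2) \<inter> (C1 \<times> C2). dist w (x1, x2) < d \<longrightarrow>
        (a, b) \<bullet> (w - (x1, x2)) \<le> e * sum_norm N1 N2 (w - (x1, x2))" if "e > 0" for e
    proof -
      obtain d1 where "d1 > 0"
        and d1: "\<And>y. y \<in> \<Omega>1 \<inter> C1 \<Longrightarrow> dist y x1 < d1 \<Longrightarrow> a \<bullet> (y - x1) \<le> e * N1 (y - x1)"
        using a \<open>e > 0\<close> unfolding iff by blast
      obtain d2 where "d2 > 0"
        and d2: "\<And>y. y \<in> \<Omega>2 \<inter> C2 \<Longrightarrow> dist y x2 < d2 \<Longrightarrow> b \<bullet> (y - x2) \<le> e * N2 (y - x2)"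
        using b \<open>e > 0\<close> unfolding iff by blast
      have "(a, b) \<bullet> (w - (x1, x2)) \<le> e * sum_norm N1 N2 (w - (x1, x2))"
        if w: "w \<in> (\<Omega>1 \<times> \<Omega>2) \<inter> (C1 \<times> C2)" "dist w (x1, x2) < min d1 d2" for w
      proof -
        \<comment> \<open>The metric \<open>dist\<close> on pairs is the Euclidean one, not the one
          induced by \<open>sum_norm\<close>; all that is used is that projections do not increase
          it.\<close>
        have "dist (fst w) x1 < d1" and "dist (snd w) x2 < d2"
          using w(2) dist_fst_le[of w "(x1, x2)"] dist_snd_le[of w "(x1, x2)"] by auto
        then have "a \<bullet> (fst w - x1) \<le> e * N1 (fst w - x1)"
          and "b \<bullet> (snd w - x2) \<le> e * N2 (snd w - x2)"
          using w(1) by (auto intro!: d1 d2)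
        \<comment> \<open>The same \<open>e\<close> was taken in both factors, so adding the
          inequalities gives exactly \<open>e\<close> times the sum norm, without halving.\<close>
        then show ?thesis
          by (cases w) (simp add: sum_norm_def algebra_simps)
      qed
      with \<open>d1 > 0\<close> \<open>d2 > 0\<close> show ?thesis
        by (intro exI[of _ "min d1 d2"]) simp
    qed
    ultimately show ?thesis
      unfolding iff by meson
  qed
  ultimately show "x' \<in> ?L \<longleftrightarrow> x' \<in> ?R1 \<times> ?R2"
    unfolding x' mem_Times_iff fst_conv snd_conv by (intro iffI) simp_all
qed

text \<open>Convergence of pairs is componentwise, so approximating sequences can be split and
  paired index by index, and the equality of the Frechet cones applies at each index.\<close>

lemma limiting_normal_cone_Times:
  fixes \<Omega>1 C1 :: "'a::euclidean_space set" and \<Omega>2 C2 :: "'b::euclidean_space set"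
  assumes "is_norm N1" "is_norm N2" and "convex C1" "convex C2"
  shows "limiting_normal_cone (sum_norm N1 N2) (C1 \<times> C2) (x1, x2) (\<Omega>1 \<times> \<Omega>2)
    = limiting_normal_cone N1 C1 x1 \<Omega>1 \<times> limiting_normal_cone N2 C2 x2 \<Omega>2"
    (is "?L = ?R1 \<times> ?R2")
proof (intro equalityI subsetI)
  \<comment> \<open>The base point is left open here, since the equality is needed at every term of
    the sequences rather than at the limit.\<close>
  note frechet = frechet_normal_cone_Times[OF assms]
  {
    fix x'
    assume "x' \<in> ?L"
    then obtain u v where u: "\<And>k. u k \<in> (\<Omega>1 \<times> \<Omega>2) \<inter> (C1 \<times> C2)" "u \<longlonglongrightarrow> (x1, x2)"
      and v: "\<And>k. v k \<in> frechet_normal_cone (sum_norm N1 N2) (C1 \<times> C2) (u k) (\<Omega>1 \<times> \<Omega>2)"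
        "v \<longlonglongrightarrow> x'"
      unfolding limiting_normal_cone_def by blast
    have u': "fst (u k) \<in> \<Omega>1 \<inter> C1" "snd (u k) \<in> \<Omega>2 \<inter> C2" for k
      using u(1)[of k] by auto
    have "v k \<in> frechet_normal_cone N1 C1 (fst (u k)) \<Omega>1
        \<times> frechet_normal_cone N2 C2 (snd (u k)) \<Omega>2" for k
      using v(1)[of k] frechet[OF u'(1)[of k] u'(2)[of k]] by (simp only: prod.collapse)
    then have v': "fst (v k) \<in> frechet_normal_cone N1 C1 (fst (u k)) \<Omega>1"
      "snd (v k) \<in> frechet_normal_cone N2 C2 (snd (u k)) \<Omega>2" for k
      by (simp_all add: mem_Times_iff)
    have "fst x' \<in> ?R1"
      unfolding limiting_normal_cone_def mem_Collect_eq
      using u' v' tendsto_fst[OF u(2)] tendsto_fst[OF v(2)]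
      by (intro exI[of _ "\<lambda>k. fst (u k)"] exI[of _ "\<lambda>k. fst (v k)"]) simp
    moreover have "snd x' \<in> ?R2"
      unfolding limiting_normal_cone_def mem_Collect_eq
      using u' v' tendsto_snd[OF u(2)] tendsto_snd[OF v(2)]
      by (intro exI[of _ "\<lambda>k. snd (u k)"] exI[of _ "\<lambda>k. snd (v k)"]) simp
    ultimately show "x' \<in> ?R1 \<times> ?R2"
      by (simp add: mem_Times_iff)
  next
    fix x'
    assume "x' \<in> ?R1 \<times> ?R2"
    then obtain a b where x': "x' = (a, b)" and "a \<in> ?R1" and "b \<in> ?R2"
      by blast
    obtain u v where u: "\<And>k. u k \<in> \<Omega>1 \<inter> C1" "u \<longlonglongrightarrow> x1"
      and v: "\<And>k. v k \<in> frechet_normal_cone N1 C1 (u k) \<Omega>1" "v \<longlonglongrightarrow> a"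
      using \<open>a \<in> ?R1\<close> unfolding limiting_normal_cone_def by blast
    obtain s t where s: "\<And>k. s k \<in> \<Omega>2 \<inter> C2" "s \<longlonglongrightarrow> x2"
      and t: "\<And>k. t k \<in> frechet_normal_cone N2 C2 (s k) \<Omega>2" "t \<longlonglongrightarrow> b"
      using \<open>b \<in> ?R2\<close> unfolding limiting_normal_cone_def by blast
    show "x' \<in> ?L"
      \<comment> \<open>Both approximations are indexed by all natural numbers, so they are paired
        at equal indices without passing to subsequences.\<close>
      unfolding limiting_normal_cone_def mem_Collect_eq x'
      using u s v t tendsto_Pair[OF u(2) s(2)] tendsto_Pair[OF v(2) t(2)]
      by (intro exI[of _ "\<lambda>k. (u k, s k)"] exI[of _ "\<lambda>k. (v k, t k)"])
        (simp add: frechet)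
  }
qed

theorem theorem7:
  fixes \<Omega>1 C1 :: "(real ^ 'n) set" and \<Omega>2 C2 :: "(real ^ 'm) set"
    and x1 :: "real ^ 'n" and x2 :: "real ^ 'm"
    and N1 :: "real ^ 'n \<Rightarrow> real" and N2 :: "real ^ 'm \<Rightarrow> real"
  assumes "is_norm N1" and "is_norm N2"
    and "\<Omega>1 \<noteq> {}" and "C1 \<noteq> {}" and "\<Omega>2 \<noteq> {}" and "C2 \<noteq> {}"
    and "closed C1" and "convex C1" and "closed C2" and "convex C2"
    and "(x1, x2) \<in> (\<Omega>1 \<inter> C1) \<times> (\<Omega>2 \<inter> C2)"
    and "locally_closed_around N1 \<Omega>1 x1" and "locally_closed_around N2 \<Omega>2 x2"
  shows "frechet_normal_cone (sum_norm N1 N2) (C1 \<times> C2) (x1, x2) (\<Omega>1 \<times> \<Omega>2)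
           = frechet_normal_cone N1 C1 x1 \<Omega>1 \<times> frechet_normal_cone N2 C2 x2 \<Omega>2
       \<and> limiting_normal_cone (sum_norm N1 N2) (C1 \<times> C2) (x1, x2) (\<Omega>1 \<times> \<Omega>2)
           = limiting_normal_cone N1 C1 x1 \<Omega>1 \<times> limiting_normal_cone N2 C2 x2 \<Omega>2"
proof
  have "x1 \<in> \<Omega>1 \<inter> C1" and "x2 \<in> \<Omega>2 \<inter> C2"
    using assms(11) by simp_all
  then show "frechet_normal_cone (sum_norm N1 N2) (C1 \<times> C2) (x1, x2) (\<Omega>1 \<times> \<Omega>2)
      = frechet_normal_cone N1 C1 x1 \<Omega>1 \<times> frechet_normal_cone N2 C2 x2 \<Omega>2"
    by (rule frechet_normal_cone_Times[OF assms(1,2,8,10)])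
  show "limiting_normal_cone (sum_norm N1 N2) (C1 \<times> C2) (x1, x2) (\<Omega>1 \<times> \<Omega>2)
      = limiting_normal_cone N1 C1 x1 \<Omega>1 \<times> limiting_normal_cone N2 C2 x2 \<Omega>2"
    by (rule limiting_normal_cone_Times[OF assms(1,2,8,10)])
qed

end
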